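(* L'vovsky's bound holds for the sumsets regularity $\sigma(A)$, that is, $$\sigma(A)\le\lambda_{\max}+\lambda_{\mathrm{sl}}+1.$$
   Context: Let $A=\{0=:a_0<a_1<\cdots<a_k=:d\}$ be a set of $k+1\ge4$ relatively prime non-negative integers. For an integer $h\ge1$, $hA=A+\cdots+A$ ($h$ summands), and $0A=\{0\}$. It is known that there are integers $c_1,c_2$ and sets $C_i\subseteq[0,c_i-2]$ ($i=1,2$), not depending on $h$, such that $$hA=C_1\sqcup[c_1,hd-c_2]\sqcup(hd-C_2)$$ for all sufficiently large integers $h$; here $[p,q]$ is the set of integers $n$ with $p\le n\le q$, used with $p\le q$ in the decomposition (so $c_1\le hd-c_2$ is required), and $[0,c_i-2]=\emptyset$ if $c_i<2$. The sumsets regularity $\sigma(A)$ is the least integer $\sigma\ge0$ such that this decomposition holds for all integers $h\ge\sigma$. The gaps of $A$ are $\lambda_i=a_i-a_{i-1}-1$, $1\le i\le k$; $\lambda_{\max}$ is the largest gap, $\lambda_{\max}=\lambda_i$ for some $i$, and $\lambda_{\mathrm{sl}}=\max\{\lambda_j\mid j\ne i\}$ is the second largest gap (counted with multiplicity). *)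

theory Defs
  imports Complex_Main "HOL-Library.Set_Algebras"
begin

text \<open>
  The \<open>h\<close>-fold sumset \<open>hA\<close>. The sum is taken in the type \<open>int set\<close> with the Minkowski
  addition of \<^theory>\<open>HOL-Library.Set_Algebras\<close>, whose zero is \<open>{0}\<close>; hence \<open>0A = {0}\<close>.
\<close>

definition sumset :: "nat \<Rightarrow> int set \<Rightarrow> int set" where
  "sumset h A = (\<Sum>_<h. A)"

text \<open>
  The structural decomposition of \<open>hA\<close>, where \<open>d = max A\<close>. The inclusions
  \<open>C\<^sub>i \<subseteq> [0, c\<^sub>i - 2]\<close> and the inequality \<open>c\<^sub>1 \<le> hd - c\<^sub>2\<close> make the three parts pairwise
  disjoint.
\<close>

definition sumset_decomposition ::
  "int set \<Rightarrow> int \<Rightarrow> int \<Rightarrow> int set \<Rightarrow> int set \<Rightarrow> nat \<Rightarrow> bool" where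
  "sumset_decomposition A c1 c2 C1 C2 h \<longleftrightarrow>
     C1 \<subseteq> {0..c1 - 2} \<and> C2 \<subseteq> {0..c2 - 2} \<and>
     c1 \<le> int h * Max A - c2 \<and>
     sumset h A = C1 \<union> {c1..int h * Max A - c2} \<union> (\<lambda>x. int h * Max A - x) ` C2"

text \<open>
  The data \<open>c\<^sub>1, c\<^sub>2, C\<^sub>1, C\<^sub>2\<close> do not depend on \<open>h\<close>. They are quantified existentially because
  the decompositions for all large \<open>h\<close> already determine them.
\<close>

definition sumsets_regularity :: "int set \<Rightarrow> nat" where
  "sumsets_regularity A =
     (LEAST \<sigma>. \<exists>c1 c2 C1 C2. \<forall>h\<ge>\<sigma>. sumset_decomposition A c1 c2 C1 C2 h)"

definition gap :: "(nat \<Rightarrow> int) \<Rightarrow> nat \<Rightarrow> int" where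
  "gap a i = a i - a (i - 1) - 1"

definition max_gap :: "(nat \<Rightarrow> int) \<Rightarrow> nat \<Rightarrow> int" where
  "max_gap a k = Max (gap a ` {1..k})"

text \<open>
  Only one index attaining the largest gap is removed, so the second largest gap is counted
  with multiplicity; its value does not depend on which maximal index is chosen.
\<close>

definition second_max_gap :: "(nat \<Rightarrow> int) \<Rightarrow> nat \<Rightarrow> int" where
  "second_max_gap a k =
     Max (gap a ` ({1..k} - {ARG_MAX (gap a) i. i \<in> {1..k}}))"

end

theory Submission
  imports Defs "HOL-Library.FuncSet"
begin

text \<open>
  Let \<open>N\<close> be the sum of the two largest differences of consecutive elements of \<open>A\<close> and
  \<open>h\<^sub>0 = N - 1\<close>. Inside the window \<open>W = {0..<N}\<close> an element of \<open>A\<close> can always be replaced by its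
  predecessor or its successor, with the window position absorbing the change: this is the
  combinatorial form of the vanishing theorem behind L'vovsky's bound.

  If each of \<open>N\<close> elements, placed on the positions of \<open>W\<close>, is moved in this way, the positions
  form a functional graph, and executing the moves along one of its cycles preserves the sum.
  A quadratic potential increases, so after finitely many steps one of the elements is \<open>0\<close> or \<open>d\<close>.
  Hence \<open>hA\<close> with \<open>h > h\<^sub>0\<close> is obtained from \<open>h\<^sub>0A\<close> by adding multiples of \<open>d\<close>, and it remains to
  see that the part of \<open>h\<^sub>0A\<close> in each residue class modulo \<open>d\<close> has no holes.

  A spanning tree of \<open>W\<close> whose edges are moves yields \<open>N\<close> consecutive elements of \<open>h\<^sub>0A\<close>, one for
  each choice of the root. Changing the tree edge by edge shows that the blocks of any two trees
  lie in one interval contained in \<open>h\<^sub>0A\<close>. The potential argument, with every element of \<open>A\<close> in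
  the role of \<open>0\<close>, and the coprimality of \<open>A\<close> show that each element of \<open>h\<^sub>0A\<close> is connected to the
  block of some tree by steps \<open>\<plusminus>d\<close> within \<open>h\<^sub>0A\<close>.
\<close>

section \<open>Sumsets\<close>

lemma sumset_0: "sumset 0 A = {0}"
  by (simp add: sumset_def)

lemma sumset_Suc: "sumset (Suc h) A = sumset h A + A"
  by (simp add: sumset_def)

lemma sumset_add:
  assumes "x \<in> sumset i A" "y \<in> sumset j A"
  shows "x + y \<in> sumset (i + j) A"
  using assms(2)
proof (induction j arbitrary: y)
  case 0
  then show ?case using assms(1) by (simp add: sumset_0)
next
  case (Suc j)
  then obtain u v where "u \<in> sumset j A" "v \<in> A" "y = u + v"
    by (auto simp: sumset_Suc elim: set_plus_elim)
  then show ?case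
    using Suc.IH[of u] set_plus_intro[of "x + u" "sumset (i + j) A" v A]
    by (simp add: sumset_Suc add.assoc)
qed

lemma sumset_add_elem: "x \<in> sumset h A \<Longrightarrow> y \<in> A \<Longrightarrow> x + y \<in> sumset (Suc h) A"
  by (simp add: sumset_Suc set_plus_intro)

lemma sumset_mult:
  assumes "y \<in> A"
  shows "int j * y \<in> sumset j A"
proof (induction j)
  case 0
  then show ?case by (simp add: sumset_0)
next
  case (Suc j)
  then show ?case using sumset_add_elem[OF Suc assms] by (simp add: algebra_simps)
qed

lemma sumset_add_mult:
  assumes "x \<in> sumset h A" "y \<in> A"
  shows "x + int j * y \<in> sumset (h + j) A"
  using sumset_add[OF assms(1) sumset_mult[OF assms(2)]] .

lemma sumset_mono:
  assumes "0 \<in> A" "h \<le> h'" "x \<in> sumset h A"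
  shows "x \<in> sumset h' A"
  using sumset_add_mult[OF assms(3,1), of "h' - h"] assms(2) by simp

lemma sumset_split:
  assumes "x \<in> sumset (i + j) A"
  obtains u v where "u \<in> sumset i A" "v \<in> sumset j A" "x = u + v"
  using assms
proof (induction j arbitrary: x thesis)
  case 0
  then show ?case by (auto simp: sumset_0)
next
  case (Suc j)
  from Suc.prems(2) obtain w c where w: "w \<in> sumset (i + j) A" "c \<in> A" "x = w + c"
    by (auto simp: sumset_Suc elim: set_plus_elim)
  obtain u v where "u \<in> sumset i A" "v \<in> sumset j A" "w = u + v"
    using Suc.IH[OF _ w(1)] by blast
  then show ?case
    using Suc.prems(1)[of u "v + c"] sumset_add_elem[of v j A c] w by (simp add: add.assoc)
qed

lemma sum_in_sumset:
  assumes "finite I" "\<And>i. i \<in> I \<Longrightarrow> f i \<in> A"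
  shows "sum f I \<in> sumset (card I) A"
  using assms
proof (induction I)
  case empty
  then show ?case by (simp add: sumset_0)
next
  case (insert i I)
  then show ?case using sumset_add_elem[of "sum f I" "card I" A "f i"] by (simp add: add.commute)
qed

lemma sumset_as_sum:
  assumes "finite I" "x \<in> sumset (card I) A"
  shows "\<exists>f \<in> I \<rightarrow>\<^sub>E A. sum f I = x"
  using assms
proof (induction I arbitrary: x)
  case empty
  then show ?case by (simp add: sumset_0)
next
  case (insert i I)
  then have "x \<in> sumset (card I) A + A" by (simp add: sumset_Suc)
  then obtain u v where uv: "u \<in> sumset (card I) A" "v \<in> A" "x = u + v"
    by (auto elim: set_plus_elim)
  obtain f where f: "f \<in> I \<rightarrow>\<^sub>E A" "sum f I = u" using insert.IH[OF uv(1)] by blast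
  have "sum (f(i := v)) I = sum f I"
    by (rule sum.cong) (use insert.hyps in auto)
  then have "sum (f(i := v)) (insert i I) = x"
    using insert.hyps f(2) uv(3) by simp
  moreover have "f(i := v) \<in> insert i I \<rightarrow>\<^sub>E A" using f uv by (auto simp: PiE_iff extensional_def)
  ultimately show ?case by blast
qed

section \<open>Permuted subsets, Bezout combinations and tails of sets of integers\<close>

text \<open>A smallest nonempty subset closed under \<open>F\<close> works, since its image is again
  closed. \<open>F\<close> permutes this finite set, which therefore serves as the cycle in the
  functional graph of moves.\<close>

lemma finite_invariant_subset:
  assumes "finite Z" "Z \<noteq> {}" "\<And>p. p \<in> Z \<Longrightarrow> F p \<in> Z"
  shows "\<exists>C. C \<subseteq> Z \<and> C \<noteq> {} \<and> F ` C = C"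
proof -
  define P where "P C \<longleftrightarrow> C \<subseteq> Z \<and> C \<noteq> {} \<and> F ` C \<subseteq> C" for C
  have "P Z" using assms by (auto simp: P_def)
  then obtain C where C: "P C" "\<And>D. P D \<Longrightarrow> card C \<le> card D"
    using arg_min_natI[of P Z card] arg_min_nat_le[of P _ card] by blast
  then have "P (F ` C)" by (auto simp: P_def)
  then have "card C \<le> card (F ` C)" using C by blast
  moreover have "finite C" "F ` C \<subseteq> C" using C(1) assms(1) by (auto simp: P_def finite_subset)
  ultimately have "F ` C = C" by (meson card_seteq)
  then show ?thesis using C(1) by (auto simp: P_def)
qed

lemma finite_bezout:
  assumes "finite I"
  shows "\<exists>u :: _ \<Rightarrow> int. (\<Sum>i\<in>I. u i * g i) = Gcd (g ` I)"
  using assms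
proof (induction I)
  case empty
  then show ?case by simp
next
  case (insert i I)
  then obtain u where u: "(\<Sum>i\<in>I. u i * g i) = Gcd (g ` I)" by blast
  obtain v w where vw: "v * g i + w * Gcd (g ` I) = gcd (g i) (Gcd (g ` I))"
    using bezout_int by blast
  have "(\<Sum>j\<in>insert i I. (if j = i then v else w * u j) * g j)
      = v * g i + (\<Sum>j\<in>I. (if j = i then v else w * u j) * g j)"
    using insert.hyps by simp
  also have "(\<Sum>j\<in>I. (if j = i then v else w * u j) * g j) = (\<Sum>j\<in>I. w * (u j * g j))"
    by (rule sum.cong) (use insert.hyps in auto)
  also have "v * g i + \<dots> = Gcd (g ` insert i I)"
    using vw u by (simp flip: sum_distrib_left)
  finally show ?case by (intro exI[of _ "\<lambda>j. if j = i then v else w * u j"])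
qed


text \<open>Supplies \<open>c1\<close> and \<open>c2\<close>: the tail is extended downwards until
  it would leave \<open>T\<close>, which happens because \<open>T\<close> is bounded below. That
  \<open>c - 1\<close> is missing is what later confines the exceptional set to
  \<open>[0, c - 2]\<close>.\<close>

lemma least_tail_start:
  fixes T :: "int set"
  assumes "T \<subseteq> {0..}" "{x..} \<subseteq> T"
  obtains c where "c \<le> x" "{c..} \<subseteq> T" "c - 1 \<notin> T"
proof -
  define m where "m = (LEAST m. \<not> {x - int m - 1..} \<subseteq> T)"
  have "\<not> {x - int (nat (x + 1)) - 1..} \<subseteq> T"
    using assms(1) by force
  then have m: "\<not> {x - int m - 1..} \<subseteq> T"
    unfolding m_def by (rule LeastI)
  have below: "{x - int l - 1..} \<subseteq> T" if "l < m" for l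
    using not_less_Least[OF that[unfolded m_def]] by blast
  have tail: "{x - int m..} \<subseteq> T"
  proof (cases m)
    case 0
    then show ?thesis using assms(2) by simp
  next
    case (Suc l)
    then show ?thesis using below[of l] by (simp add: algebra_simps)
  qed
  have "x - int m - 1 \<notin> T"
  proof
    assume *: "x - int m - 1 \<in> T"
    have "{x - int m - 1..} \<subseteq> T"
    proof
      fix z assume "z \<in> {x - int m - 1..}"
      then have "z = x - int m - 1 \<or> z \<in> {x - int m..}" by auto
      then show "z \<in> T" using * tail by blast
    qed
    then show False using m by blast
  qed
  with tail show ?thesis using that[of "x - int m"] by simp
qed

section \<open>Moves in a window\<close>

text \<open>Gaps enter only through \<open>step_pair\<close>: of two different steps, when one
  overshoots the top of a window of length \<open>N\<close>, the other still fits below.\<close>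

locale step_sequence =
  fixes a :: "nat \<Rightarrow> int" and k :: nat and N :: int
  assumes k_ge: "2 \<le> k"
    and a_0: "a 0 = 0"
    and a_mono: "strict_mono_on {0..k} a"
    and step_pair: "i \<in> {1..k} \<Longrightarrow> j \<in> {1..k} \<Longrightarrow> i \<noteq> j \<Longrightarrow>
      (a i - a (i - 1)) + (a j - a (j - 1)) \<le> N"
    and Gcd_a: "Gcd (a ` {0..k}) = 1"
begin

definition A :: "int set" where "A = a ` {0..k}"
definition d :: int where "d = a k"
definition W :: "int set" where "W = {0..<N}"
definition h0 :: nat where "h0 = nat (N - 1)"
definition H :: "int set" where "H = sumset h0 A"

lemma a_less: "i < j \<Longrightarrow> j \<le> k \<Longrightarrow> a i < a j"
  using a_mono by (auto simp: strict_mono_on_def)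

lemma step_pos: "i \<in> {1..k} \<Longrightarrow> a (i - 1) < a i"
  by (rule a_less) auto

lemma step_less: "i \<in> {1..k} \<Longrightarrow> a i - a (i - 1) < N"
proof -
  assume i: "i \<in> {1..k}"
  define j where "j = (if i = 1 then k else 1)"
  have "j \<in> {1..k}" "i \<noteq> j" using k_ge by (auto simp: j_def)
  with step_pair[OF i this] step_pos[of j] show ?thesis by linarith
qed

lemma N_gt: "1 < N"
  using step_less[of 1] step_pos[of 1] k_ge by auto

lemma a_le: "i \<le> j \<Longrightarrow> j \<le> k \<Longrightarrow> a i \<le> a j"
  using a_less[of i j] by (cases "i = j") auto

lemma A_range: "c \<in> A \<Longrightarrow> 0 \<le> c \<and> c \<le> d"
  unfolding A_def d_def using a_le a_0 by (metis atLeastAtMost_iff imageE order_refl)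

lemma d_pos: "0 < d"
  using a_less[of 0 k] k_ge a_0 by (simp add: d_def)

lemma zero_A: "0 \<in> A" and d_A: "d \<in> A" and a_A: "i \<le> k \<Longrightarrow> a i \<in> A"
  by (auto simp: A_def d_def a_0 intro: rev_image_eqI[of 0])

lemma finite_A: "finite A"
  by (simp add: A_def)

lemma finite_W: "finite W" and zero_W: "0 \<in> W" and card_W: "card W = Suc h0"
  using N_gt by (auto simp: W_def h0_def)

lemma adjacent:
  assumes "i \<in> {1..k}" "c \<in> A"
  shows "c \<le> a (i - 1) \<or> a i \<le> c"
proof -
  obtain j where j: "j \<le> k" "c = a j" using assms(2) by (auto simp: A_def)
  then show ?thesis using assms(1) a_le[of j "i - 1"] a_le[of i j] by (cases "j \<le> i - 1") auto
qed

lemma congruent_elements: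
  assumes "c \<in> A" "c' \<in> A" "d dvd c - c'"
  shows "c = c' \<or> c = c' + d \<or> c' = c + d"
proof -
  from assms(3) obtain q where q: "c - c' = d * q" by blast
  have "- d \<le> d * q" "d * q \<le> d" using assms A_range[of c] A_range[of c'] q by auto
  then have "-1 \<le> q" "q \<le> 1" using d_pos
    by (smt (verit) mult_less_cancel_left2 mult_minus_right mult_cancel_left1 mult_le_cancel_left1)+
  then have "q = -1 \<or> q = 0 \<or> q = 1" by auto
  then show ?thesis using q by auto
qed

text \<open>
  The position of an element on the circle of length \<open>d\<close>, counted from \<open>\<alpha>\<close>; the endpoints \<open>0\<close>
  and \<open>d\<close> of \<open>A\<close> are one point of the circle.
\<close>

definition pos :: "int \<Rightarrow> int \<Rightarrow> int" where "pos \<alpha> c = (c - \<alpha>) mod d"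

text \<open>Being an element of \<open>A\<close>, \<alpha> is never strictly between two neighbours.
  A step forward on the circle thus either adds its length to the position or lands on \<alpha>
  itself.\<close>

lemma pos_step:
  assumes "\<alpha> \<in> A" "i \<in> {1..k}"
  shows "pos \<alpha> (a i) = pos \<alpha> (a (i - 1)) + (a i - a (i - 1)) \<or> pos \<alpha> (a i) = 0"
proof (cases "\<alpha> \<le> a (i - 1)")
  case True
  have r: "a i \<le> d" "0 \<le> \<alpha>" "a (i - 1) < a i"
    using assms A_range a_A[of i] step_pos[of i] by auto
  have "pos \<alpha> (a (i - 1)) = a (i - 1) - \<alpha>"
    unfolding pos_def by (rule mod_pos_pos_trivial) (use True r in auto)
  moreover have "pos \<alpha> (a i) = a i - \<alpha> \<or> pos \<alpha> (a i) = 0"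
  proof (cases "a i - \<alpha> = d")
    case True
    then show ?thesis by (simp add: pos_def)
  next
    case False
    then have "pos \<alpha> (a i) = a i - \<alpha>"
      unfolding pos_def by (intro mod_pos_pos_trivial) (use True r in auto)
    then show ?thesis by simp
  qed
  ultimately show ?thesis by auto
next
  case False
  then have \<alpha>: "a i \<le> \<alpha>" using adjacent[OF assms(2,1)] by auto
  have r: "0 \<le> a (i - 1)" "\<alpha> \<le> d" "a (i - 1) < a i"
    using assms A_range a_A[of "i - 1"] step_pos[of i] by auto
  have eq: "pos \<alpha> c = (c - \<alpha> + d) mod d" for c by (simp add: pos_def)
  have "pos \<alpha> (a (i - 1)) = a (i - 1) - \<alpha> + d"
    unfolding eq by (rule mod_pos_pos_trivial) (use \<alpha> r in auto)
  moreover have "pos \<alpha> (a i) = a i - \<alpha> + d \<or> pos \<alpha> (a i) = 0"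
  proof (cases "a i = \<alpha>")
    case True
    then show ?thesis by (simp add: pos_def)
  next
    case False
    then have "pos \<alpha> (a i) = a i - \<alpha> + d"
      unfolding eq by (intro mod_pos_pos_trivial) (use \<alpha> r in auto)
    then show ?thesis by simp
  qed
  ultimately show ?thesis by auto
qed

lemma pos_eq_0_iff: "pos \<alpha> c = 0 \<longleftrightarrow> d dvd c - \<alpha>"
  by (auto simp: pos_def)

lemma pos_cong: "d dvd c - c' \<Longrightarrow> pos \<alpha> c = pos \<alpha> c'"
proof -
  assume "d dvd c - c'"
  then have "d dvd (c - \<alpha>) - (c' - \<alpha>)" by simp
  then show ?thesis unfolding pos_def by (simp add: mod_eq_dvd_iff)
qed

text \<open>On the circle one step \<open>j\<close> ends at \<open>c\<close> and a different step
  \<open>i\<close> starts there. Going back along \<open>j\<close> raises the window position, going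
  forward along \<open>i\<close> lowers it; as the two lengths sum to at most \<open>N\<close>, one
  of the moves stays in \<open>W\<close>. For \<open>c\<close> equal to \<open>0\<close> or
  \<open>d\<close> the steps are the last and the first, so \<open>c1\<close> is only congruent to
  \<open>c\<close>.\<close>

lemma window_move:
  assumes "p \<in> W" "c \<in> A" "\<alpha> \<in> A" "pos \<alpha> c \<noteq> 0"
  obtains q c1 c2 where "q \<in> W" "q \<noteq> p" "c1 \<in> A" "c2 \<in> A" "d dvd c1 - c" "p + c1 = q + c2"
    "pos \<alpha> c2 = pos \<alpha> c + p - q \<or> pos \<alpha> c2 = 0"
proof -
  obtain i j where ij: "i \<in> {1..k}" "j \<in> {1..k}" "i \<noteq> j"
    "d dvd a (i - 1) - c" "d dvd a j - c"
  proof (cases "c = 0 \<or> c = d")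
    case True
    then show ?thesis using that[of 1 k] k_ge a_0 by (auto simp: d_def)
  next
    case False
    then obtain t where t: "t \<le> k" "c = a t" using assms(2) by (auto simp: A_def)
    then have "t \<noteq> 0" "t \<noteq> k" using False a_0 by (auto simp: d_def intro!: gr0I)
    then show ?thesis using that[of "t + 1" t] t by auto
  qed
  show ?thesis
  proof (cases "p + (a j - a (j - 1)) < N")
    case True
    have "pos \<alpha> (a j) = pos \<alpha> c" using ij(5) by (rule pos_cong)
    then show ?thesis
      using that[of "p + (a j - a (j - 1))" "a j" "a (j - 1)"] True assms ij
        step_pos[OF ij(2)] pos_step[OF assms(3) ij(2)] a_A[of j] a_A[of "j - 1"]
      by (auto simp: W_def)
  next
    case False
    have "pos \<alpha> (a (i - 1)) = pos \<alpha> c" using ij(4) by (rule pos_cong)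
    then show ?thesis
      using that[of "p - (a i - a (i - 1))" "a (i - 1)" "a i"] False assms ij
        step_pair[OF ij(1-3)] step_pos[OF ij(1)] pos_step[OF assms(3) ij(1)] a_A[of i] a_A[of "i - 1"]
      by (auto simp: W_def)
  qed
qed

text \<open>Extensionality makes the set of fillings finite, so that a potential has a maximum on
  it. \<open>S\<close> will be a singleton in the reduction to \<open>H\<close> and a class of
  chained totals in the construction of trees.\<close>

definition fillings :: "int set \<Rightarrow> int set \<Rightarrow> (int \<Rightarrow> int) set" where
  "fillings Z S = {f \<in> Z \<rightarrow>\<^sub>E A. sum f Z \<in> S}"

text \<open>
  Along a cycle \<open>F\<close> of moves, maximality of \<open>\<Psi>\<close> against the filling merely permuted by \<open>F\<close> bounds
  the mixed terms; what remains of the change of \<open>\<Psi>\<close> is half the sum of \<open>(p - F p)\<^sup>2\<close>.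
\<close>

lemma spread:
  assumes Z: "Z \<subseteq> W" "Z \<noteq> {}" and \<alpha>: "\<alpha> \<in> A" and ne: "fillings Z S \<noteq> {}"
    and flip: "\<And>f p c. f \<in> fillings Z S \<Longrightarrow> p \<in> Z \<Longrightarrow> c \<in> A \<Longrightarrow> d dvd c - f p \<Longrightarrow>
      f(p := c) \<in> fillings Z S"
    and closed: "\<And>f p c. f \<in> fillings Z S \<Longrightarrow> p \<in> Z \<Longrightarrow> c \<in> A \<Longrightarrow> p + f p - c \<in> W \<Longrightarrow>
      p + f p - c \<in> Z"
  shows "\<exists>f \<in> fillings Z S. \<exists>p \<in> Z. d dvd f p - \<alpha>"
proof (rule ccontr)
  assume contra: "\<not> ?thesis"
  then have nz: "pos \<alpha> (f p) \<noteq> 0" if "f \<in> fillings Z S" "p \<in> Z" for f p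
    using that by (auto simp: pos_eq_0_iff)
  have finZ: "finite Z" using Z(1) finite_W by (rule finite_subset)
  define \<Psi> where "\<Psi> f = (\<Sum>p\<in>Z. pos \<alpha> (f p) * (pos \<alpha> (f p) + p))" for f
  have "finite (fillings Z S)"
    unfolding fillings_def using finZ finite_A
    by (intro finite_subset[OF _ finite_PiE[of Z "\<lambda>_. A"]]) auto
  then obtain f where f: "f \<in> fillings Z S" and max: "\<And>g. g \<in> fillings Z S \<Longrightarrow> \<Psi> g \<le> \<Psi> f"
    using ne obtains_MAX[of "fillings Z S" \<Psi>] by (metis Max_ge finite_imageI imageI)
  have fA: "f p \<in> A" if "p \<in> Z" for p using f that by (auto simp: fillings_def)
  define R where "R p q c1 c2 \<longleftrightarrow> q \<in> Z \<and> q \<noteq> p \<and> c1 \<in> A \<and> c2 \<in> A \<and> d dvd c1 - f p \<and>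
      p + c1 = q + c2 \<and> (pos \<alpha> c2 = pos \<alpha> (f p) + p - q \<or> pos \<alpha> c2 = 0)" for p q c1 c2
  have "\<exists>q c1 c2. R p q c1 c2" if p: "p \<in> Z" for p
  proof -
    from p Z have "p \<in> W" by auto
    from window_move[OF this fA[OF p] \<alpha> nz[OF f p]] obtain q c1 c2 where
      q: "q \<in> W" "q \<noteq> p" "c1 \<in> A" "c2 \<in> A" "d dvd c1 - f p" "p + c1 = q + c2"
      "pos \<alpha> c2 = pos \<alpha> (f p) + p - q \<or> pos \<alpha> c2 = 0" .
    have "q = p + (f(p := c1)) p - c2" using q by simp
    then have "q \<in> Z" using closed[OF flip[OF f p q(3,5)] p q(4)] q(1) by simp
    then show ?thesis using q unfolding R_def by blast
  qed
  then obtain F c1 c2 where "\<And>p. p \<in> Z \<Longrightarrow> R p (F p) (c1 p) (c2 p)" by metis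
  then have F: "\<And>p. p \<in> Z \<Longrightarrow> F p \<in> Z" "\<And>p. p \<in> Z \<Longrightarrow> F p \<noteq> p"
    "\<And>p. p \<in> Z \<Longrightarrow> c1 p \<in> A" "\<And>p. p \<in> Z \<Longrightarrow> c2 p \<in> A" "\<And>p. p \<in> Z \<Longrightarrow> d dvd c1 p - f p"
    "\<And>p. p \<in> Z \<Longrightarrow> p + c1 p = F p + c2 p"
    "\<And>p. p \<in> Z \<Longrightarrow> pos \<alpha> (c2 p) = pos \<alpha> (f p) + p - F p \<or> pos \<alpha> (c2 p) = 0"
    by (simp_all add: R_def)
  obtain C where C: "C \<subseteq> Z" "C \<noteq> {}" "F ` C = C"
    using finite_invariant_subset[of Z F, OF finZ Z(2) F(1)] by blast
  have finC: "finite C" using C(1) finZ by (rule finite_subset)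
  have inj: "inj_on F C" using finC C(3) by (simp add: eq_card_imp_inj_on)
  define G where "G = inv_into C F"
  have G: "G (F p) = p" if "p \<in> C" for p using inj that by (simp add: G_def)
  have reindex: "sum g C = (\<Sum>p\<in>C. g (F p))" for g :: "int \<Rightarrow> int"
    using sum.reindex[OF inj, of g] C(3) by simp
  have split: "(\<Sum>x\<in>Z. g x) = (\<Sum>x\<in>Z - C. g x) + (\<Sum>x\<in>C. g x)" for g :: "int \<Rightarrow> int"
    using sum.subset_diff[OF C(1) finZ] .
  have replace: "(\<Sum>x\<in>Z. u x (if x \<in> C then g x else f x)) =
      (\<Sum>x\<in>Z. u x (f x)) - (\<Sum>x\<in>C. u x (f x)) + (\<Sum>p\<in>C. u (F p) (g (F p)))"
    for g and u :: "int \<Rightarrow> int \<Rightarrow> int"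
  proof -
    have "(\<Sum>x\<in>Z. u x (if x \<in> C then g x else f x)) =
        (\<Sum>x\<in>Z - C. u x (f x)) + (\<Sum>x\<in>C. u x (g x))"
      by (subst split) (intro arg_cong2[of _ _ _ _ "(+)"] sum.cong, auto)
    then show ?thesis
      using split[of "\<lambda>x. u x (f x)"] reindex[of "\<lambda>x. u x (g x)"] by simp
  qed
  \<comment> \<open>The congruent replacements \<open>c1\<close> are made first, one position at a
    time, because \<open>flip\<close> alters a single value. The subsequent exchange along
    \<open>F\<close> keeps the sum, as \<open>F\<close> permutes \<open>C\<close>.\<close>
  have "(\<lambda>x. if x \<in> D then c1 x else f x) \<in> fillings Z S" if "finite D" "D \<subseteq> Z" for D
    using that
  proof (induction D)
    case empty
    then show ?case using f by simp
  next
    case (insert p D)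
    have "(\<lambda>x. if x \<in> insert p D then c1 x else f x) = (\<lambda>x. if x \<in> D then c1 x else f x)(p := c1 p)"
      by auto
    then show ?case
      using flip[OF insert.IH, of p "c1 p"] insert.hyps insert.prems F by auto
  qed
  from this[OF finC C(1)]
  have "(\<Sum>x\<in>Z. f x) - (\<Sum>p\<in>C. f p) + (\<Sum>p\<in>C. c1 p) \<in> S"
    using replace[of "\<lambda>_ c. c" c1] reindex[of c1] by (simp add: fillings_def)
  moreover have "(\<Sum>p\<in>C. c1 p) = (\<Sum>p\<in>C. c2 p)"
  proof -
    have "(\<Sum>p\<in>C. c1 p) = (\<Sum>p\<in>C. F p + c2 p - p)"
      by (rule sum.cong) (use F(6) C(1) in \<open>auto simp: algebra_simps\<close>)
    then show ?thesis using reindex[of "\<lambda>p. p"] by (simp add: sum.distrib sum_subtractf)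
  qed
  ultimately have "(\<Sum>x\<in>Z. f x) - (\<Sum>p\<in>C. f p) + (\<Sum>p\<in>C. c2 p) \<in> S" by simp
  moreover define f2 where "f2 x = (if x \<in> C then c2 (G x) else f x)" for x
  ultimately have "sum f2 Z \<in> S"
    using replace[of "\<lambda>_ c. c" "\<lambda>x. c2 (G x)"] G by simp
  moreover have GC: "G x \<in> C" if "x \<in> C" for x using C(3) that unfolding G_def by (metis inv_into_into)
  then have "f2 \<in> Z \<rightarrow>\<^sub>E A"
    using f F(4) C(1) by (auto simp: f2_def fillings_def PiE_iff extensional_def)
  ultimately have f2: "f2 \<in> fillings Z S" by (simp add: fillings_def)
  define f3 where "f3 x = (if x \<in> C then f (G x) else f x)" for x
  have "f3 \<in> Z \<rightarrow>\<^sub>E A"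
    using f GC C(1) by (auto simp: f3_def fillings_def PiE_iff extensional_def)
  moreover have "sum f3 Z = sum f Z"
    using replace[of "\<lambda>_ c. c" "\<lambda>x. f (G x)"] G by (simp add: f3_def)
  ultimately have f3: "f3 \<in> fillings Z S" using f by (simp add: fillings_def)
  define b where "b p = pos \<alpha> (f p)" for p
  \<comment> \<open>The alternative of position \<open>0\<close> would put an element congruent to
    \<alpha> into the filling \<open>f2\<close>, which is excluded.\<close>
  have b2: "pos \<alpha> (c2 p) = b p + p - F p" if "p \<in> C" for p
  proof -
    have "f2 (F p) = c2 p" using that C(3) G by (auto simp: f2_def)
    moreover have "F p \<in> Z" using that C(1) F(1) by auto
    ultimately have "pos \<alpha> (c2 p) \<noteq> 0" using nz[OF f2, of "F p"] by simp
    then show ?thesis using F(7)[of p] that C(1) by (auto simp: b_def)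
  qed
  have "\<Psi> f3 = \<Psi> f - (\<Sum>p\<in>C. b p * (b p + p)) + (\<Sum>p\<in>C. b p * (b p + F p))"
    using replace[of "\<lambda>x c. pos \<alpha> c * (pos \<alpha> c + x)" "\<lambda>x. f (G x)"] G
    by (simp add: \<Psi>_def f3_def b_def)
  with max[OF f3] have le: "(\<Sum>p\<in>C. b p * (b p + F p)) \<le> (\<Sum>p\<in>C. b p * (b p + p))"
    by simp
  have "\<Psi> f2 = \<Psi> f - (\<Sum>p\<in>C. b p * (b p + p)) + (\<Sum>p\<in>C. (b p + p - F p) * (b p + p))"
    using replace[of "\<lambda>x c. pos \<alpha> c * (pos \<alpha> c + x)" "\<lambda>x. c2 (G x)"] G b2
    by (simp add: \<Psi>_def f2_def b_def)
  with max[OF f2] have "(\<Sum>p\<in>C. (b p + p - F p) * (b p + p)) \<le> (\<Sum>p\<in>C. b p * (b p + p))"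
    by simp
  \<comment> \<open>The squares \<open>p\<^sup>2\<close> and \<open>(F p)\<^sup>2\<close> cancel
    after summation over the permuted set \<open>C\<close>.\<close>
  moreover have "(\<Sum>p\<in>C. 2 * ((b p + p - F p) * (b p + p))) =
      (\<Sum>p\<in>C. 2 * (2 * (b p * (b p + p)) - b p * (b p + F p)) + (p - F p)\<^sup>2 + p\<^sup>2 - (F p)\<^sup>2)"
    by (rule sum.cong) (simp_all add: algebra_simps power2_eq_square)
  then have "2 * (\<Sum>p\<in>C. (b p + p - F p) * (b p + p)) =
      2 * (2 * (\<Sum>p\<in>C. b p * (b p + p)) - (\<Sum>p\<in>C. b p * (b p + F p))) + (\<Sum>p\<in>C. (p - F p)\<^sup>2)"
    using reindex[of "\<lambda>p. p\<^sup>2"]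
    by (simp add: sum.distrib sum_subtractf flip: sum_distrib_left)
  moreover have "0 < (\<Sum>p\<in>C. (p - F p)\<^sup>2)"
    by (rule sum_pos[OF finC C(2)]) (use F(2) C(1) in fastforce)
  moreover have "\<not> (x \<le> y \<and> 2 * x = 2 * (2 * y - z) + w \<and> 0 < w \<and> z \<le> y)" for x y z w :: int
    by presburger
  ultimately show False using le by blast
qed

section \<open>Reduction of large sumsets to \<open>H\<close> by multiples of
  \<open>d\<close>\<close>

lemma sumset_reduce_window:
  assumes "n \<in> sumset (Suc h0) A"
  shows "n \<in> H \<or> n - d \<in> H"
proof -
  let ?Q = "fillings W {n}"
  \<comment> \<open>The detour through a contradiction secures \<open>flip\<close>: if no filling
    uses \<open>0\<close> or \<open>d\<close>, congruent values are equal.\<close>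
  have "\<exists>f \<in> ?Q. \<exists>p \<in> W. d dvd f p - 0"
  proof (rule ccontr)
    assume contra: "\<not> ?thesis"
    have "\<exists>f \<in> ?Q. \<exists>p \<in> W. d dvd f p - 0"
    proof (rule spread[OF order_refl _ zero_A])
      show "W \<noteq> {}" using zero_W by auto
      show "?Q \<noteq> {}"
        using sumset_as_sum[OF finite_W, of n A] assms by (auto simp: fillings_def card_W)
    next
      fix f p c assume *: "f \<in> ?Q" "p \<in> W" "c \<in> A" "d dvd c - f p"
      have "f p \<in> A" using * by (auto simp: fillings_def)
      moreover have "\<not> d dvd f p" using contra *(1,2) by simp
      then have "f p \<noteq> 0" "f p \<noteq> d" by auto
      ultimately have "c = f p"
        using congruent_elements[of c "f p"] * A_range[of c] A_range[of "f p"] by auto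
      then show "f(p := c) \<in> ?Q" using * by simp
    qed
    with contra show False by blast
  qed
  then obtain f p where f: "f \<in> W \<rightarrow>\<^sub>E A" "sum f W = n" "p \<in> W" "d dvd f p"
    by (auto simp: fillings_def)
  have "sum f (W - {p}) \<in> sumset (card (W - {p})) A"
    by (rule sum_in_sumset) (use f finite_W in auto)
  then have "n - f p \<in> H"
    using f finite_W by (simp add: card_W H_def sum_diff1)
  moreover have "f p \<in> A" using f by auto
  then have "f p = 0 \<or> f p = d"
    using congruent_elements[of "f p" 0] f zero_A A_range[of "f p"] d_pos by auto
  ultimately show ?thesis by auto
qed

lemma sumset_reduce:
  assumes "n \<in> sumset (h0 + j) A"
  shows "\<exists>i \<le> j. n - int i * d \<in> H"
  using assms
proof (induction j arbitrary: n)
  case 0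
  then show ?case by (simp add: H_def)
next
  case (Suc j)
  then have "n \<in> sumset (Suc h0 + j) A" by simp
  then obtain u v where uv: "u \<in> sumset (Suc h0) A" "v \<in> sumset j A" "n = u + v"
    by (rule sumset_split)
  from sumset_reduce_window[OF uv(1)] show ?case
  proof
    assume "u \<in> H"
    then have "n \<in> sumset (h0 + j) A" using sumset_add uv by (auto simp: H_def)
    then obtain i where "i \<le> j" "n - int i * d \<in> H" using Suc.IH by blast
    then show ?case using le_SucI by blast
  next
    assume "u - d \<in> H"
    then have "(u - d) + v \<in> sumset (h0 + j) A" using sumset_add uv by (simp add: H_def)
    moreover have "(u - d) + v = n - d" using uv by simp
    ultimately have "n - d \<in> sumset (h0 + j) A" by simp
    then obtain i where "i \<le> j" "n - d - int i * d \<in> H" using Suc.IH by blast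
    then show ?case by (intro exI[of _ "Suc i"]) (simp add: algebra_simps)
  qed
qed

section \<open>Connectedness of the window under moves\<close>

text \<open>The prescribed signed steps can be ordered so as to stay in \<open>W\<close>. If a
  pending upward step \<open>i\<close> and a pending downward step \<open>j\<close> both left
  \<open>W\<close>, their lengths would sum to more than \<open>N\<close>. If only one sign is
  pending and a step leaves \<open>W\<close>, so does the target.\<close>

lemma window_path:
  assumes Z: "Z \<subseteq> W"
    and closed: "\<And>p i. p \<in> Z \<Longrightarrow> i \<in> {1..k} \<Longrightarrow> p + (a i - a (i - 1)) \<in> W \<Longrightarrow> p + (a i - a (i - 1)) \<in> Z"
      "\<And>p i. p \<in> Z \<Longrightarrow> i \<in> {1..k} \<Longrightarrow> p - (a i - a (i - 1)) \<in> W \<Longrightarrow> p - (a i - a (i - 1)) \<in> Z"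
    and "p \<in> Z" "p + (\<Sum>i=1..k. u i * (a i - a (i - 1))) \<in> W"
  shows "p + (\<Sum>i=1..k. u i * (a i - a (i - 1))) \<in> Z"
  using assms(4,5)
proof (induction "\<Sum>i=1..k. nat \<bar>u i\<bar>" arbitrary: u p rule: less_induct)
  case less
  let ?e = "\<lambda>i. a i - a (i - 1)"
  let ?t = "\<Sum>i=1..k. u i * ?e i"
  have pW: "p \<in> W" using less.prems Z by auto
  have upd: "(\<Sum>i=1..k. (u(j := c)) i * ?e i) = ?t + (c - u j) * ?e j" if "j \<in> {1..k}" for j c
  proof -
    have "(\<Sum>i=1..k. (u(j := c)) i * ?e i) = c * ?e j + (\<Sum>i\<in>{1..k} - {j}. u i * ?e i)"
      using that by (subst sum.remove[of _ j]) auto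
    also have "(\<Sum>i\<in>{1..k} - {j}. u i * ?e i) = ?t - u j * ?e j"
      using that by (simp add: sum_diff1)
    finally show ?thesis by (simp add: algebra_simps)
  qed
  have smaller: "(\<Sum>i=1..k. nat \<bar>(u(j := c)) i\<bar>) < (\<Sum>i=1..k. nat \<bar>u i\<bar>)"
    if "j \<in> {1..k}" "\<bar>c\<bar> < \<bar>u j\<bar>" for j c
    by (rule sum_strict_mono_ex1) (use that in \<open>auto intro!: bexI[of _ j]\<close>)
  consider (up) j where "j \<in> {1..k}" "0 < u j" "p + ?e j \<in> W"
    | (down) j where "j \<in> {1..k}" "u j < 0" "p - ?e j \<in> W"
    | (stuck) "\<And>j. j \<in> {1..k} \<Longrightarrow> 0 < u j \<Longrightarrow> p + ?e j \<notin> W"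
      "\<And>j. j \<in> {1..k} \<Longrightarrow> u j < 0 \<Longrightarrow> p - ?e j \<notin> W"
    by blast
  then show ?case
  proof cases
    case up
    show ?thesis
      using less.hyps[OF smaller[of j "u j - 1"], of "p + ?e j"] closed(1)[of p j] less.prems up
        upd[of j "u j - 1"] by simp
  next
    case down
    show ?thesis
      using less.hyps[OF smaller[of j "u j + 1"], of "p - ?e j"] closed(2)[of p j] less.prems down
        upd[of j "u j + 1"] by simp
  next
    case stuck
    show ?thesis
    proof (cases "\<exists>i\<in>{1..k}. 0 < u i")
      case True
      then obtain i where i: "i \<in> {1..k}" "0 < u i" by blast
      then have big: "N \<le> p + ?e i" using stuck(1)[OF i] pW step_pos[of i] by (auto simp: W_def)
      have "0 \<le> u j" if "j \<in> {1..k}" for j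
      proof (rule ccontr)
        assume "\<not> 0 \<le> u j"
        then have j: "u j < 0" by simp
        then have "i \<noteq> j" using i by auto
        then show False
          using stuck(2)[OF that j] big step_pair[OF i(1) that] step_pos[OF that] pW
          by (auto simp: W_def)
      qed
      then have "0 \<le> (\<Sum>j\<in>{1..k} - {i}. u j * ?e j)"
        by (intro sum_nonneg mult_nonneg_nonneg) (use step_pos in force)+
      moreover have "1 * ?e i \<le> u i * ?e i"
        by (rule mult_right_mono) (use i step_pos[OF i(1)] in auto)
      ultimately have "?e i \<le> ?t" using i by (simp add: sum_diff1)
      then show ?thesis using big less.prems by (auto simp: W_def)
    next
      case False
      show ?thesis
      proof (cases "\<exists>i\<in>{1..k}. u i < 0")
        case True
        then obtain i where i: "i \<in> {1..k}" "u i < 0" by blast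
        then have big: "p - ?e i < 0" using stuck(2)[OF i] pW step_pos[of i] by (auto simp: W_def)
        have "(\<Sum>j\<in>{1..k} - {i}. u j * ?e j) \<le> 0"
          by (intro sum_nonpos mult_nonpos_nonneg) (use step_pos False in force)+
        moreover have "u i * ?e i \<le> (- 1) * ?e i"
          by (rule mult_right_mono) (use i step_pos[OF i(1)] in auto)
        ultimately have "?t \<le> - ?e i" using i by (simp add: sum_diff1)
        then show ?thesis using big less.prems by (auto simp: W_def)
      next
        case no_neg: False
        then have "u i = 0" if "i \<in> {1..k}" for i using False that by force
        then have "?t = 0" by simp
        then show ?thesis using less.prems by simp
      qed
    qed
  qed
qed

lemma steps_bezout: "\<exists>u. (\<Sum>i=1..k. u i * (a i - a (i - 1))) = 1"
proof -
  let ?g = "Gcd ((\<lambda>i. a i - a (i - 1)) ` {1..k})"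
  have "?g dvd a j" if "j \<le> k" for j
    using that
  proof (induction j)
    case 0
    then show ?case by (simp add: a_0)
  next
    case (Suc j)
    have "?g dvd a (Suc j) - a (Suc j - 1)" by (rule Gcd_dvd, rule image_eqI[of _ _ "Suc j"]) (use Suc in auto)
    then have "?g dvd (a (Suc j) - a j) + a j" using Suc by (intro dvd_add) auto
    then show ?case by simp
  qed
  then have "?g dvd Gcd (a ` {0..k})" by (intro Gcd_greatest) auto
  then have "\<bar>?g\<bar> = 1" using Gcd_a zdvd1_eq by metis
  moreover have "0 \<le> ?g" by (rule Gcd_int_greater_eq_0)
  ultimately have "?g = 1" by linarith
  then show ?thesis
    using finite_bezout[of "{1..k}" "\<lambda>i. a i - a (i - 1)"] by simp
qed

text \<open>A Bezout combination of the steps, scaled by \<open>q - p\<close>, is a list of signed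
  steps from \<open>p\<close> to \<open>q\<close>, which \<open>window_path\<close> carries out
  inside the window.\<close>

lemma window_connected:
  assumes Z: "Z \<subseteq> W" "Z \<noteq> {}"
    and closed: "\<And>p \<alpha> c. p \<in> Z \<Longrightarrow> \<alpha> \<in> A \<Longrightarrow> c \<in> A \<Longrightarrow> p + \<alpha> - c \<in> W \<Longrightarrow> p + \<alpha> - c \<in> Z"
  shows "Z = W"
proof -
  obtain p where p: "p \<in> Z" using Z by auto
  obtain u where u: "(\<Sum>i=1..k. u i * (a i - a (i - 1))) = 1" using steps_bezout by blast
  have "q \<in> Z" if q: "q \<in> W" for q
  proof -
    have eq: "(\<Sum>i=1..k. ((q - p) * u i) * (a i - a (i - 1))) = q - p"
      using u by (simp add: mult.assoc flip: sum_distrib_left)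
    have 1: "p' + (a i - a (i - 1)) \<in> Z"
      if "p' \<in> Z" "i \<in> {1..k}" "p' + (a i - a (i - 1)) \<in> W" for p' i
      using closed[of p' "a i" "a (i - 1)"] that a_A[of i] a_A[of "i - 1"] by (auto simp: algebra_simps)
    have 2: "p' - (a i - a (i - 1)) \<in> Z"
      if "p' \<in> Z" "i \<in> {1..k}" "p' - (a i - a (i - 1)) \<in> W" for p' i
      using closed[of p' "a (i - 1)" "a i"] that a_A[of i] a_A[of "i - 1"] by (auto simp: algebra_simps)
    show ?thesis
      using window_path[OF Z(1) 1 2 p, of "\<lambda>i. (q - p) * u i"] q eq by simp
  qed
  then show ?thesis using Z by auto
qed

section \<open>Trees of moves\<close>

text \<open>
  A tree on \<open>X\<close> with root \<open>0\<close>: the vertex \<open>q\<close> is joined to its parent \<open>par q\<close> because \<open>q + lab q\<close>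
  equals \<open>par q\<close> plus an element of \<open>A\<close>. Exchanging these two elements along a path to the
  root moves the total of all labels by the difference of the end points.
\<close>

definition tree :: "int set \<Rightarrow> (int \<Rightarrow> int) \<Rightarrow> (int \<Rightarrow> int) \<Rightarrow> (int \<Rightarrow> nat) \<Rightarrow> bool" where
  "tree X par lab rk \<longleftrightarrow> 0 \<in> X \<and> X \<subseteq> W \<and> (\<forall>q \<in> X - {0}.
     par q \<in> X \<and> rk (par q) < rk q \<and> lab q \<in> A \<and> q + lab q - par q \<in> A)"

text \<open>The root carries no label, so exactly \<open>h0\<close> summands remain and the total of
  a tree on \<open>W\<close> lies in \<open>H\<close>.\<close>

definition total :: "(int \<Rightarrow> int) \<Rightarrow> int" where
  "total lab = (\<Sum>q\<in>W - {0}. lab q)"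

text \<open>\<open>D\<close> consists of the vertices other than the root on the path from
  \<open>q\<close> to the root, along which the sum telescopes. The rank bound keeps
  \<open>q\<close> off the path of its parent.\<close>

lemma tree_path:
  assumes "tree X par lab rk" "q \<in> X"
  shows "\<exists>D \<subseteq> X - {0}. (\<forall>u\<in>D. rk u \<le> rk q) \<and> (\<Sum>u\<in>D. u - par u) = q"
  using assms(2)
proof (induction "rk q" arbitrary: q rule: less_induct)
  case less
  show ?case
  proof (cases "q = 0")
    case True
    then show ?thesis by (intro exI[of _ "{}"]) auto
  next
    case False
    then have par: "par q \<in> X" "rk (par q) < rk q" using assms(1) less.prems by (auto simp: tree_def)
    from less.hyps[OF par(2,1)] obtain D where
      D: "D \<subseteq> X - {0}" "\<forall>u\<in>D. rk u \<le> rk (par q)" "(\<Sum>u\<in>D. u - par u) = par q" by blast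
    have "q \<notin> D" using D(2) par(2) by auto
    moreover have "finite D"
      using D(1) assms(1) finite_W by (meson Diff_subset finite_subset subset_trans tree_def)
    ultimately have "(\<Sum>u\<in>insert q D. u - par u) = q" using D(3) by simp
    then show ?thesis using D par False less.prems by (intro exI[of _ "insert q D"]) auto
  qed
qed

lemma tree_block:
  assumes "tree W par lab rk" "q \<in> W"
  shows "total lab + q \<in> H"
proof -
  obtain D where D: "D \<subseteq> W - {0}" "(\<Sum>u\<in>D. u - par u) = q"
    using tree_path[OF assms] by blast
  have fin: "finite (W - {0})" using finite_W by simp
  let ?g = "\<lambda>u. if u \<in> D then u + lab u - par u else lab u"
  have "sum ?g (W - {0}) = (\<Sum>u\<in>W - {0}. lab u + (if u \<in> D then u - par u else 0))"
    by (rule sum.cong) auto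
  also have "\<dots> = total lab + q"
    using D fin by (simp add: total_def sum.distrib sum.If_cases Int_absorb1)
  finally have "sum ?g (W - {0}) = total lab + q" .
  moreover have "sum ?g (W - {0}) \<in> sumset (card (W - {0})) A"
    by (rule sum_in_sumset[OF fin]) (use assms(1) in \<open>auto simp: tree_def\<close>)
  ultimately show ?thesis using card_W zero_W finite_W by (simp add: H_def)
qed

section \<open>Overlapping blocks of different trees\<close>

text \<open>The interval spans the blocks of length \<open>N\<close> starting at \<open>x\<close>
  and at \<open>y\<close> and all that lies between. Two such intervals with a common block unite to
  an interval, whence transitivity.\<close>

definition linked :: "int \<Rightarrow> int \<Rightarrow> bool" where
  "linked x y \<longleftrightarrow> (\<forall>z. min x y \<le> z \<longrightarrow> z < max x y + N \<longrightarrow> z \<in> H)"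

lemma linked_sym: "linked x y \<Longrightarrow> linked y x"
  by (simp add: linked_def min.commute max.commute)

lemma linked_trans:
  assumes "linked x y" "linked y z"
  shows "linked x z"
  unfolding linked_def
proof (intro allI impI)
  fix w assume w: "min x z \<le> w" "w < max x z + N"
  show "w \<in> H"
  proof (cases "min x y \<le> w \<and> w < max x y + N")
    case True
    then show ?thesis using assms(1) by (simp add: linked_def)
  next
    case False
    then have "min y z \<le> w" "w < max y z + N" using w N_gt by linarith+
    then show ?thesis using assms(2) by (simp add: linked_def)
  qed
qed

lemma tree_linked_refl: "tree W par lab rk \<Longrightarrow> linked (total lab) (total lab)"
proof -
  assume t: "tree W par lab rk"
  show ?thesis unfolding linked_def
  proof (intro allI impI)
    fix z assume "min (total lab) (total lab) \<le> z" "z < max (total lab) (total lab) + N"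
    then have "z - total lab \<in> W" by (simp add: W_def)
    from tree_block[OF t this] show "z \<in> H" by simp
  qed
qed

lemma total_update:
  assumes "v \<in> W" "v \<noteq> 0"
  shows "total (lab(v := c)) = total lab - lab v + c"
proof -
  have fin: "finite (W - {0})" using finite_W by simp
  have "total (lab(v := c)) = c + (\<Sum>q\<in>W - {0} - {v}. lab q)"
    unfolding total_def using assms fin by (subst sum.remove[of _ v]) auto
  also have "(\<Sum>q\<in>W - {0} - {v}. lab q) = total lab - lab v"
    unfolding total_def using assms fin by (simp add: sum_diff1)
  finally show ?thesis by linarith
qed

text \<open>For an interior index \<open>j\<close> both neighbours of \<open>a j\<close> exist, and
  by \<open>step_pair\<close> one of the two moves from \<open>v\<close> stays in the window; its
  end is the new parent. No vertex hangs on \<open>v\<close>, so no cycle can arise.\<close>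

lemma tree_relabel_leaf:
  assumes t: "tree W par lab rk" and v: "v \<in> W" "v \<noteq> 0"
    and leaf: "\<And>q. q \<in> W - {0} \<Longrightarrow> par q \<noteq> v" and j: "j \<in> {1..k - 1}"
  shows "\<exists>par' rk'. tree W par' (lab(v := a j)) rk'"
proof -
  have j1: "j \<in> {1..k}" "j + 1 \<in> {1..k}" using j k_ge by auto
  obtain u where u: "u \<in> W" "u \<noteq> v" "v + a j - u \<in> A"
  proof (cases "v + (a j - a (j - 1)) < N")
    case True
    then show ?thesis
      using that[of "v + (a j - a (j - 1))"] v step_pos[OF j1(1)] a_A[of "j - 1"] j
      by (auto simp: W_def)
  next
    case False
    then show ?thesis
      using that[of "v - (a (j + 1) - a j)"] v step_pos[OF j1(2)] step_pair[OF j1] a_A[of "j + 1"] j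
      by (auto simp: W_def)
  qed
  define rk' where "rk' = rk(v := Suc (rk u))"
  have "tree W (par(v := u)) (lab(v := a j)) rk'"
    unfolding tree_def
  proof (intro conjI ballI)
    fix q assume q: "q \<in> W - {0}"
    have *: "par q \<in> W" "rk (par q) < rk q" "lab q \<in> A" "q + lab q - par q \<in> A"
      using t q by (auto simp: tree_def)
    show "(par(v := u)) q \<in> W" using * u by auto
    show "rk' ((par(v := u)) q) < rk' q" using * u leaf[OF q] by (auto simp: rk'_def)
    show "(lab(v := a j)) q \<in> A" using * a_A[of j] j by auto
    show "q + (lab(v := a j)) q - (par(v := u)) q \<in> A" using * u by auto
  qed (use zero_W in auto)
  then show ?thesis by blast
qed

text \<open>While the label of the leaf runs through the interior elements of \<open>A\<close>, the
  block shifts by less than \<open>N\<close> each time, so consecutive blocks overlap.\<close>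

lemma leaf_run:
  assumes t: "tree W par lab rk" and v: "v \<in> W" "v \<noteq> 0"
    and leaf: "\<And>q. q \<in> W - {0} \<Longrightarrow> par q \<noteq> v"
  shows "linked (total lab - lab v + a 1) (total lab - lab v + a (k - 1))"
proof -
  let ?b = "total lab - lab v"
  have "linked (?b + a 1) (?b + a j)" if "j \<in> {1..k - 1}" for j
    using that
  proof (induction j)
    case 0
    then show ?case by simp
  next
    case (Suc j)
    obtain par' rk' where "tree W par' (lab(v := a (Suc j))) rk'"
      using tree_relabel_leaf[OF t v leaf Suc.prems] by blast
    from tree_linked_refl[OF this]
    have new: "linked (?b + a (Suc j)) (?b + a (Suc j))" using total_update[OF v] by simp
    show ?case
    proof (cases "j = 0")
      case True
      then show ?thesis using new by simp
    next
      case False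
      then have IH: "linked (?b + a 1) (?b + a j)" using Suc by auto
      have "a 1 \<le> a j" "a j < a (Suc j)" "a (Suc j) - a j < N"
        using Suc.prems False a_le[of 1 j] step_pos[of "Suc j"] step_less[of "Suc j"] by auto
      then show ?thesis using IH new unfolding linked_def
        by (smt (verit, best))
    qed
  qed
  then show ?thesis using k_ge by simp
qed

text \<open>An interior label is already part of the run. A label \<open>0\<close> or
  \<open>d\<close> puts the block less than \<open>N\<close> away from one end of the run, which it
  then overlaps.\<close>

lemma leaf_linked:
  assumes t: "tree W par lab rk" and v: "v \<in> W" "v \<noteq> 0"
    and leaf: "\<And>q. q \<in> W - {0} \<Longrightarrow> par q \<noteq> v"
  shows "linked (total lab) (total lab - lab v + a 1)"
proof -
  let ?b = "total lab - lab v"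
  have run: "linked (?b + a 1) (?b + a (k - 1))" by (rule leaf_run[OF assms])
  have self: "linked (?b + lab v) (?b + lab v)" using tree_linked_refl[OF t] by simp
  have "lab v \<in> A" using t v by (auto simp: tree_def)
  then obtain j where j: "j \<le> k" "lab v = a j" by (auto simp: A_def)
  have st: "a 1 \<le> a (k - 1)" "0 < a 1" "a 1 < N" "a (k - 1) < a k" "a k - a (k - 1) < N"
    using a_le[of 1 "k - 1"] step_pos[of 1] step_pos[of k] step_less[of 1] step_less[of k] k_ge a_0
    by auto
  have "linked (?b + lab v) (?b + a 1)"
  proof -
    consider "j = 0" | "j = k" | "j \<in> {1..k - 1}" using j by fastforce
    then show ?thesis
    proof cases
      case 1
      then show ?thesis using run self st a_0 j unfolding linked_def by (smt (verit, best))
    next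
      case 2
      then show ?thesis using run self st j unfolding linked_def by (smt (verit, best))
    next
      case 3
      then have "a 1 \<le> a j" "a j \<le> a (k - 1)" using a_le k_ge by auto
      then show ?thesis using run j unfolding linked_def by (smt (verit, best))
    qed
  qed
  then show ?thesis by simp
qed

text \<open>By \<open>step_pair\<close> for the first and the last step, the run of a leaf has
  length at least \<open>d\<close>. Two runs whose starting points differ by at most
  \<open>d\<close> therefore overlap or adjoin.\<close>

lemma leaf_exchange:
  assumes t: "tree W par lab rk" "tree W par' lab' rk'" and v: "v \<in> W" "v \<noteq> 0"
    and leaf: "\<And>q. q \<in> W - {0} \<Longrightarrow> par q \<noteq> v" "\<And>q. q \<in> W - {0} \<Longrightarrow> par' q \<noteq> v"
    and diff: "\<bar>(total lab' - lab' v) - (total lab - lab v)\<bar> \<le> d"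
  shows "linked (total lab) (total lab')"
proof -
  let ?b = "total lab - lab v" and ?b' = "total lab' - lab' v"
  have "a 1 + (a k - a (k - 1)) \<le> N"
    using step_pair[of 1 k] k_ge a_0 by simp
  then have "linked (?b + a 1) (?b' + a 1)"
    using leaf_run[OF t(1) v leaf(1)] leaf_run[OF t(2) v leaf(2)] diff a_le[of 1 "k - 1"] k_ge
    unfolding linked_def d_def by (smt (verit, best) diff_le_self)
  with leaf_linked[OF t(1) v leaf(1)] leaf_linked[OF t(2) v leaf(2)]
  show ?thesis by (blast intro: linked_trans linked_sym)
qed

text \<open>
  Replacing the parents in the first tree by those in the second, one vertex at a time and
  downwards from the root, keeps a tree, and each replacement leaves some leaf untouched.
\<close>

lemma tree_merge:
  assumes t: "tree W par1 lab1 rk1" "tree W par2 lab2 rk2"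
    and D: "0 \<in> D" "D \<subseteq> W" "\<And>q. q \<in> D - {0} \<Longrightarrow> par2 q \<in> D"
  shows "\<exists>rk. tree W (\<lambda>q. if q \<in> D then par2 q else par1 q) (\<lambda>q. if q \<in> D then lab2 q else lab1 q) rk"
proof -
  define M where "M = Suc (Max (rk2 ` W))"
  have M: "rk2 q < M" if "q \<in> W" for q
    unfolding M_def using that finite_W by (simp add: le_imp_less_Suc)
  define rk where "rk q = (if q \<in> D then rk2 q else M + rk1 q)" for q
  have "tree W (\<lambda>q. if q \<in> D then par2 q else par1 q) (\<lambda>q. if q \<in> D then lab2 q else lab1 q) rk"
    unfolding tree_def
  proof (intro conjI ballI)
    fix q assume q: "q \<in> W - {0}"
    then have 1: "par1 q \<in> W" "rk1 (par1 q) < rk1 q" "lab1 q \<in> A" "q + lab1 q - par1 q \<in> A"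
      and 2: "par2 q \<in> W" "rk2 (par2 q) < rk2 q" "lab2 q \<in> A" "q + lab2 q - par2 q \<in> A"
      using t by (auto simp: tree_def)
    show "(if q \<in> D then par2 q else par1 q) \<in> W" using 1 2 by simp
    show "rk (if q \<in> D then par2 q else par1 q) < rk q"
      using 1 2 D(3)[of q] q M[of "par1 q"] by (auto simp: rk_def)
    show "(if q \<in> D then lab2 q else lab1 q) \<in> A" using 1 2 by simp
    show "q + (if q \<in> D then lab2 q else lab1 q) - (if q \<in> D then par2 q else par1 q) \<in> A"
      using 1 2 by simp
  qed (use zero_W in auto)
  then show ?thesis by blast
qed

lemma trees_linked:
  assumes t: "tree W par1 lab1 rk1" "tree W par2 lab2 rk2"
  shows "linked (total lab1) (total lab2)"
proof -
  have "linked (total lab1) (total (\<lambda>q. if q \<in> D then lab2 q else lab1 q))"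
    if "0 \<in> D" "D \<subseteq> W" "\<And>q. q \<in> D - {0} \<Longrightarrow> par2 q \<in> D" for D
    using that
  proof (induction "card D" arbitrary: D rule: less_induct)
    case less
    have finD: "finite D" using less.prems finite_W by (blast intro: finite_subset)
    show ?case
    proof (cases "D = {0}")
      case True
      then have "total (\<lambda>q. if q \<in> D then lab2 q else lab1 q) = total lab1"
        unfolding total_def by (intro sum.cong) auto
      then show ?thesis using tree_linked_refl[OF t(1)] by simp
    next
      case False
      then have ne: "D - {0} \<noteq> {}" using less.prems by auto
      \<comment> \<open>By maximality of the rank, \<open>q\<close> is the second parent of no
        vertex in \<open>D\<close>, so its removal keeps \<open>D\<close> closed under
        \<open>par2\<close>.\<close>
      obtain q where q: "q \<in> D - {0}" and qmax: "\<And>u. u \<in> D - {0} \<Longrightarrow> rk2 u \<le> rk2 q"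
        using obtains_MAX[of "D - {0}" rk2] finD ne by (metis Max_ge finite_Diff finite_imageI imageI)
      have par2: "rk2 (par2 u) < rk2 u" if "u \<in> D - {0}" for u
        using that t(2) less.prems(2) by (auto simp: tree_def)
      define D0 where "D0 = D - {q}"
      have "par2 u \<in> D0" if "u \<in> D0 - {0}" for u
        using that less.prems(3)[of u] par2[of u] qmax[of u] by (auto simp: D0_def)
      then have D0: "0 \<in> D0" "D0 \<subseteq> W" "\<And>u. u \<in> D0 - {0} \<Longrightarrow> par2 u \<in> D0"
        using less.prems q by (auto simp: D0_def)
      have "card D0 < card D" using q finD unfolding D0_def by (intro psubset_card_mono) auto
      then have IH: "linked (total lab1) (total (\<lambda>q. if q \<in> D0 then lab2 q else lab1 q))"
        using less.hyps D0 by blast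
      let ?P = "\<lambda>D q. if q \<in> D then par2 q else par1 q"
      let ?L = "\<lambda>D q. if q \<in> D then lab2 q else lab1 q"
      obtain r r0 where trees: "tree W (?P D) (?L D) r" "tree W (?P D0) (?L D0) r0"
        using tree_merge[OF t less.prems] tree_merge[OF t D0] by blast
      have qW: "q \<in> W" "q \<noteq> 0" "q \<in> W - D0" using q less.prems by (auto simp: D0_def)
      \<comment> \<open>This \<open>v\<close> is a leaf of both merged trees: vertices outside
        \<open>D0\<close> that keep their first parent have rank at most that of \<open>v\<close>,
        all others have parents in \<open>D0\<close>. Possibly \<open>v = q\<close>; then the totals
        without the label of \<open>v\<close> agree.\<close>
      obtain v where v: "v \<in> W - D0" and vmax: "\<And>u. u \<in> W - D0 \<Longrightarrow> rk1 u \<le> rk1 v"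
        using obtains_MAX[of "W - D0" rk1] finite_W qW(3)
        by (metis Max_ge empty_iff finite_Diff finite_imageI imageI)
      then have v0: "v \<in> W" "v \<noteq> 0" using D0 by auto
      have no_child: "par1 u \<noteq> v" if "u \<in> W - D0" "u \<noteq> 0" for u
      proof -
        have "rk1 (par1 u) < rk1 u" using t(1) that by (auto simp: tree_def)
        then show ?thesis using vmax[OF that(1)] by auto
      qed
      have leaf0: "?P D0 u \<noteq> v" if "u \<in> W - {0}" for u
        using D0(3)[of u] no_child[of u] that v by auto
      have parq: "par2 q \<in> D0"
        using less.prems(3)[of q] q par2[of q] by (auto simp: D0_def)
      have leaf: "?P D u \<noteq> v" if "u \<in> W - {0}" for u
      proof (cases "u = q")
        case True
        then show ?thesis using parq v q by auto
      next
        case False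
        then have "?P D u = ?P D0 u" by (auto simp: D0_def)
        then show ?thesis using leaf0[OF that] by simp
      qed
      have upd: "?L D = (?L D0)(q := lab2 q)" using q by (auto simp: D0_def)
      have "total (?L D) = total (?L D0) - lab1 q + lab2 q"
        unfolding upd using total_update[OF qW(1,2), of "?L D0"] by (simp add: D0_def)
      moreover have "lab1 q \<in> A" "lab2 q \<in> A" using t qW by (auto simp: tree_def)
      then have "\<bar>lab2 q - lab1 q\<bar> \<le> d" using A_range[of "lab1 q"] A_range[of "lab2 q"] by auto
      moreover have "?L D v = (if v = q then lab2 q else ?L D0 v)" "?L D0 q = lab1 q"
        using q by (auto simp: D0_def)
      ultimately have "\<bar>(total (?L D) - ?L D v) - (total (?L D0) - ?L D0 v)\<bar> \<le> d"
        using d_pos by (cases "v = q") simp_all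
      from leaf_exchange[OF trees(2,1) v0 leaf0 leaf this]
      show ?thesis using IH linked_trans by blast
    qed
  qed
  from this[of W] have "linked (total lab1) (total (\<lambda>q. if q \<in> W then lab2 q else lab1 q))"
    using t(2) by (auto simp: tree_def)
  moreover have "total (\<lambda>q. if q \<in> W then lab2 q else lab1 q) = total lab2"
    unfolding total_def by (rule sum.cong) auto
  ultimately show ?thesis by simp
qed

section \<open>Residue classes modulo \<open>d\<close> inside \<open>H\<close>\<close>

text \<open>Expresses that \<open>t\<close> is reached from \<open>s\<close> by steps of length
  \<open>d\<close> within \<open>H\<close>.\<close>

definition chained :: "int \<Rightarrow> int \<Rightarrow> bool" where
  "chained s t \<longleftrightarrow> d dvd t - s \<and>
     (\<forall>x. d dvd x - s \<longrightarrow> min s t \<le> x \<longrightarrow> x \<le> max s t \<longrightarrow> x \<in> H)"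

lemma chained_refl: "s \<in> H \<Longrightarrow> chained s s"
  by (auto simp: chained_def)

lemma chained_sym:
  assumes "chained s t"
  shows "chained t s"
proof -
  have "d dvd t - s" using assms by (simp add: chained_def)
  then have "d dvd x - s" if "d dvd x - t" for x using dvd_add[OF that \<open>d dvd t - s\<close>] by simp
  moreover have "d dvd s - t" using \<open>d dvd t - s\<close> by (simp add: dvd_diff_commute)
  ultimately show ?thesis using assms by (simp add: chained_def min.commute max.commute)
qed

lemma chained_trans:
  assumes "chained s t" "chained t u"
  shows "chained s u"
  unfolding chained_def
proof (intro conjI allI impI)
  have 1: "d dvd t - s" "d dvd u - t" using assms by (auto simp: chained_def)
  show "d dvd u - s" using dvd_add[OF 1] by simp
  fix x assume x: "d dvd x - s" "min s u \<le> x" "x \<le> max s u"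
  have "d dvd x - t" using dvd_diff[OF x(1) 1(1)] by simp
  then show "x \<in> H" using assms x unfolding chained_def by (smt (verit, best))
qed

lemma chained_step:
  assumes "s \<in> H" "t \<in> H" "t = s + d \<or> s = t + d \<or> s = t"
  shows "chained s t"
  unfolding chained_def
proof (intro conjI allI impI)
  show "d dvd t - s" using assms(3) by auto
  fix x assume x: "d dvd x - s" "min s t \<le> x" "x \<le> max s t"
  then obtain q where q: "x - s = d * q" by blast
  have "- d \<le> d * q" "d * q \<le> d" using x assms(3) d_pos unfolding q[symmetric] by auto
  then have "d * (-1) \<le> d * q" "d * q \<le> d * 1" by simp_all
  then have "-1 \<le> q" "q \<le> 1" using d_pos by (simp_all only: mult_le_cancel_left_pos)
  then have "q = -1 \<or> q = 0 \<or> q = 1" by linarith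
  then have "x = s - d \<or> x = s \<or> x = s + d" using q by auto
  then have "x = s \<or> x = t" using x assms(3) d_pos by auto
  then show "x \<in> H" using assms by auto
qed

lemma linked_chained: "linked x y \<Longrightarrow> d dvd y - x \<Longrightarrow> chained x y"
  using N_gt by (auto simp: linked_def chained_def)

text \<open>Write \<open>s\<close> as a sum over \<open>W - {0}\<close> and let a tree absorb as
  many positions as possible, while the total stays chained to \<open>s\<close>. If positions
  \<open>Z\<close> remained, every element of \<open>A\<close> could be brought to every one of
  them, and no move could lead into the tree. Then \<open>Z\<close> would be all of
  \<open>W\<close>, although the root is in the tree.\<close>

lemma chained_to_tree:
  assumes "s \<in> H"
  obtains par lab rk where "tree W par lab rk" "chained s (total lab)"
proof -
  define P where "P X \<longleftrightarrow> (\<exists>par lab rk. \<exists>f \<in> (W - X) \<rightarrow>\<^sub>E A. tree X par lab rk \<and>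
      chained s ((\<Sum>q\<in>X - {0}. lab q) + sum f (W - X)))" for X
  have "card (W - {0}) = h0" using card_W zero_W finite_W by simp
  then obtain f0 where "f0 \<in> (W - {0}) \<rightarrow>\<^sub>E A" "sum f0 (W - {0}) = s"
    using sumset_as_sum[of "W - {0}" s A] assms finite_W by (auto simp: H_def)
  then have "P {0}"
    unfolding P_def using chained_refl[OF assms] zero_W by (auto simp: tree_def)
  moreover have "card X < Suc (card W)" if "P X" for X
    using that finite_W by (auto simp: P_def tree_def intro!: card_mono le_imp_less_Suc)
  ultimately obtain X where X: "P X" and Xmax: "\<And>Y. P Y \<Longrightarrow> card Y \<le> card X"
    using ex_has_greatest_nat[of P "{0}" card "Suc (card W)"] by blast
  from X obtain par lab rk f where f: "f \<in> (W - X) \<rightarrow>\<^sub>E A" and t: "tree X par lab rk"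
    and ch: "chained s ((\<Sum>q\<in>X - {0}. lab q) + sum f (W - X))"
    by (auto simp: P_def)
  define K where "K = (\<Sum>q\<in>X - {0}. lab q)"
  define Z where "Z = W - X"
  define S where "S = {u. chained s (K + u)}"
  have XW: "X \<subseteq> W" "0 \<in> X" and finX: "finite X" and finZ: "finite Z"
    using t finite_W by (auto simp: tree_def Z_def intro: finite_subset)
  have "Z = {}"
  proof (rule ccontr)
    assume Zne: "Z \<noteq> {}"
    have fS: "f \<in> fillings Z S" using f ch by (simp add: fillings_def Z_def S_def K_def)
    have card: "card (X - {0}) + card Z = h0"
    proof -
      have "card X \<le> card W" "0 < card X" using XW finX finite_W by (auto intro: card_mono simp: card_gt_0_iff)
      then show ?thesis
        using XW finX finite_W card_W by (simp add: Z_def card_Diff_subset)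
    qed
    have inH: "K + sum g Z \<in> H" if "g \<in> Z \<rightarrow>\<^sub>E A" for g
    proof -
      have "K \<in> sumset (card (X - {0})) A"
        unfolding K_def by (rule sum_in_sumset) (use finX t in \<open>auto simp: tree_def\<close>)
      moreover have "sum g Z \<in> sumset (card Z) A"
        by (rule sum_in_sumset) (use finZ that in auto)
      ultimately have "K + sum g Z \<in> sumset (card (X - {0}) + card Z) A" by (rule sumset_add)
      then show ?thesis using card by (simp add: H_def)
    qed
    have upd: "sum (g(p := c)) Z = sum g Z - g p + c" if "p \<in> Z" for g p and c :: int
    proof -
      have "sum (g(p := c)) Z = c + (\<Sum>x\<in>Z - {p}. g x)"
        using that finZ by (subst sum.remove[of _ p]) auto
      also have "(\<Sum>x\<in>Z - {p}. g x) = sum g Z - g p" using that finZ by (simp add: sum_diff1)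
      finally show ?thesis by linarith
    qed
    have flip: "g(p := c) \<in> fillings Z S"
      if g: "g \<in> fillings Z S" and p: "p \<in> Z" "c \<in> A" "d dvd c - g p" for g p c
    proof -
      have gA: "g \<in> Z \<rightarrow>\<^sub>E A" "g p \<in> A" using g p by (auto simp: fillings_def)
      have g': "g(p := c) \<in> Z \<rightarrow>\<^sub>E A" using gA p by (auto simp: PiE_iff extensional_def)
      have "chained (K + sum g Z) (K + sum (g(p := c)) Z)"
      proof (intro chained_step inH gA g')
        show "K + sum (g(p := c)) Z = K + sum g Z + d \<or> K + sum g Z = K + sum (g(p := c)) Z + d \<or>
            K + sum g Z = K + sum (g(p := c)) Z"
          unfolding upd[OF p(1)] using congruent_elements[OF p(2) gA(2) p(3)] by auto
      qed
      moreover have "chained s (K + sum g Z)" using g by (simp add: fillings_def S_def)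
      ultimately show ?thesis using g' chained_trans by (auto simp: fillings_def S_def)
    qed
    \<comment> \<open>Otherwise \<open>p\<close> could be attached to the tree with label
      \<open>g p\<close>, against the maximality of \<open>X\<close>.\<close>
    have closed: "p + g p - c \<in> Z"
      if g: "g \<in> fillings Z S" and p: "p \<in> Z" "c \<in> A" "p + g p - c \<in> W" for g p c
    proof (rule ccontr)
      assume "p + g p - c \<notin> Z"
      then have u: "p + g p - c \<in> X" using p by (auto simp: Z_def)
      have gA: "g \<in> Z \<rightarrow>\<^sub>E A" "g p \<in> A" using g p by (auto simp: fillings_def)
      have pX: "p \<notin> X" "p \<in> W" "p \<noteq> 0" using p XW by (auto simp: Z_def)
      let ?par = "par(p := p + g p - c)" and ?lab = "lab(p := g p)"
      let ?rk = "rk(p := Suc (rk (p + g p - c)))"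
      have neq: "par q \<noteq> p" if "q \<in> X - {0}" for q using t that pX by (auto simp: tree_def)
      have t': "tree (insert p X) ?par ?lab ?rk"
        unfolding tree_def
      proof (intro conjI ballI)
        fix q assume q: "q \<in> insert p X - {0}"
        show "?par q \<in> insert p X" "?rk (?par q) < ?rk q" "?lab q \<in> A" "q + ?lab q - ?par q \<in> A"
          using t q neq[of q] u gA p(2) pX by (auto simp: tree_def)
      qed (use XW pX in auto)
      have "(\<Sum>q\<in>insert p X - {0}. ?lab q) = g p + K"
      proof -
        have "insert p X - {0} = insert p (X - {0})" using pX by auto
        moreover have "sum ?lab (X - {0}) = K"
          unfolding K_def by (rule sum.cong) (use pX in auto)
        ultimately show ?thesis using pX finX by simp
      qed
      moreover have "sum (restrict g (W - insert p X)) (W - insert p X) = sum g Z - g p"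
      proof -
        have "W - insert p X = Z - {p}" by (auto simp: Z_def)
        then show ?thesis using finZ p by (simp add: sum_diff1)
      qed
      moreover have "restrict g (W - insert p X) \<in> (W - insert p X) \<rightarrow>\<^sub>E A"
        using gA by (auto simp: Z_def)
      moreover have "chained s (K + sum g Z)" using g by (simp add: fillings_def S_def)
      ultimately have "P (insert p X)" unfolding P_def using t'
        by (intro exI bexI[of _ "restrict g (W - insert p X)"] conjI) (assumption, simp_all)
      from Xmax[OF this] show False using finX pX by simp
    qed
    \<comment> \<open>\<open>spread\<close> produces \<alpha> up to congruence at some position
      \<open>p0\<close>. Interchanging values preserves the sum and so carries \<alpha> to
      \<open>p\<close>.\<close>
    have swap: "\<exists>g \<in> fillings Z S. g p = \<alpha>" if \<alpha>A: "\<alpha> \<in> A" and pZ: "p \<in> Z" for \<alpha> p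
    proof -
      obtain g p0 where g: "g \<in> fillings Z S" "p0 \<in> Z" "d dvd g p0 - \<alpha>"
      proof -
        have "\<exists>g \<in> fillings Z S. \<exists>p0 \<in> Z. d dvd g p0 - \<alpha>"
        proof (rule spread)
          show "Z \<subseteq> W" by (auto simp: Z_def)
          show "fillings Z S \<noteq> {}" using fS by blast
        qed (use Zne \<alpha>A flip closed in blast)+
        then show ?thesis using that by blast
      qed
      then have g1: "g(p0 := \<alpha>) \<in> fillings Z S"
        using flip[OF g(1,2) \<alpha>A] by (simp add: dvd_diff_commute)
      have gA: "g \<in> Z \<rightarrow>\<^sub>E A" "g p \<in> A" using g pZ by (auto simp: fillings_def)
      show ?thesis
      proof (cases "p = p0")
        case True
        then show ?thesis using g1 by (intro bexI[of _ "g(p0 := \<alpha>)"]) auto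
      next
        case False
        let ?g = "g(p0 := g p, p := \<alpha>)"
        have "sum ?g Z = sum (g(p0 := \<alpha>)) Z"
          using upd[OF pZ, of "g(p0 := g p)" \<alpha>] upd[OF g(2), of g "g p"] upd[OF g(2), of g \<alpha>] False
          by simp
        moreover have "?g \<in> Z \<rightarrow>\<^sub>E A"
          using gA g pZ \<alpha>A by (auto simp: PiE_iff extensional_def)
        ultimately have "?g \<in> fillings Z S" using g1 by (simp add: fillings_def)
        then show ?thesis by (intro bexI[of _ ?g]) auto
      qed
    qed
    have "Z = W"
    proof (rule window_connected)
      fix p \<alpha> c assume *: "p \<in> Z" "\<alpha> \<in> A" "c \<in> A" "p + \<alpha> - c \<in> W"
      obtain g where "g \<in> fillings Z S" "g p = \<alpha>" using swap[OF *(2,1)] by blast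
      then show "p + \<alpha> - c \<in> Z" using closed[of g p c] * by simp
    qed (use Zne in \<open>auto simp: Z_def\<close>)
    then show False using XW zero_W by (auto simp: Z_def)
  qed
  then have "X = W" using XW by (auto simp: Z_def)
  then show ?thesis using that[of par lab rk] t ch by (simp add: total_def)
qed

lemma base_convex:
  assumes "s \<in> H" "t \<in> H" "d dvd t - s"
  shows "chained s t"
proof -
  obtain par1 lab1 rk1 where 1: "tree W par1 lab1 rk1" "chained s (total lab1)"
    using chained_to_tree[OF assms(1)] .
  obtain par2 lab2 rk2 where 2: "tree W par2 lab2 rk2" "chained t (total lab2)"
    using chained_to_tree[OF assms(2)] .
  have "d dvd total lab1 - s" "d dvd total lab2 - t"
    using 1 2 by (auto simp: chained_def)
  then have "d dvd (t - s) + (total lab2 - t) - (total lab1 - s)"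
    using assms(3) by (blast intro: dvd_add dvd_diff)
  then have "chained (total lab1) (total lab2)"
    using trees_linked[OF 1(1) 2(1)] by (intro linked_chained) simp_all
  then show ?thesis using 1(2) 2(2) chained_trans chained_sym by blast
qed

section \<open>The structure of the sumsets\<close>

definition S :: "int set" where "S = {n. \<exists>j. n \<in> sumset j A}"
text \<open>The union of the sumsets of the reflected set \<open>d - A\<close>.\<close>

definition S' :: "int set" where "S' = {n. \<exists>j. int j * d - n \<in> sumset j A}"

lemma sumset_range:
  assumes "n \<in> sumset h A"
  shows "0 \<le> n \<and> n \<le> int h * d"
  using assms
proof (induction h arbitrary: n)
  case 0
  then show ?case by (simp add: sumset_0)
next
  case (Suc h)
  then obtain u v where "u \<in> sumset h A" "v \<in> A" "n = u + v"
    by (auto simp: sumset_Suc elim: set_plus_elim)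
  then show ?case using Suc.IH[of u] A_range[of v] by (auto simp: algebra_simps)
qed

text \<open>Membership in \<open>S\<close> reduces to \<open>n - int i * d\<close> in
  \<open>H\<close>, the condition on \<open>S'\<close> to \<open>n + t * d\<close> in
  \<open>H\<close> with \<open>- t\<close> at most \<open>h - h0\<close>. If \<open>t\<close> is
  nonnegative, \<open>base_convex\<close> puts \<open>n\<close> between them into \<open>H\<close>;
  otherwise adding \<open>d\<close> exactly \<open>- t\<close> times leads back to \<open>n\<close>
  within \<open>h\<close> summands.\<close>

lemma sumset_eq:
  assumes "h0 \<le> h"
  shows "sumset h A = {n. n \<in> S \<and> int h * d - n \<in> S'}"
proof (intro equalityI subsetI CollectI)
  fix n assume "n \<in> sumset h A"
  then have "int h * d - (int h * d - n) \<in> sumset h A" by simp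
  then show "n \<in> S \<and> int h * d - n \<in> S'" using \<open>n \<in> sumset h A\<close> unfolding S_def S'_def by blast
next
  fix n assume "n \<in> {n. n \<in> S \<and> int h * d - n \<in> S'}"
  then obtain j l where "n \<in> sumset j A" and l: "int l * d - (int h * d - n) \<in> sumset l A"
    by (auto simp: S_def S'_def)
  then have "n \<in> sumset (h0 + j) A" using sumset_mono[OF zero_A, of j "h0 + j"] by simp
  then obtain i where i: "n - int i * d \<in> H" using sumset_reduce by blast
  have "int l * d - (int h * d - n) + int h * d \<in> sumset (l + h) A"
    using sumset_add_mult[OF l d_A] .
  then have "n + int l * d \<in> sumset (h0 + (l + h - h0)) A"
    using assms by (simp add: add.commute)
  then obtain i' where i': "i' \<le> l + h - h0" "n + int l * d - int i' * d \<in> H"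
    using sumset_reduce by blast
  define t where "t = int l - int i'"
  have t: "n + t * d \<in> H" "- t \<le> int (h - h0)"
    using i' assms by (auto simp: t_def algebra_simps)
  show "n \<in> sumset h A"
  proof (cases "0 \<le> t")
    case True
    have "d dvd (n + t * d) - (n - int i * d)"
      by (rule dvdI[of _ _ "t + int i"]) (simp add: algebra_simps)
    then have "chained (n - int i * d) (n + t * d)" by (rule base_convex[OF i t(1)])
    moreover have "n - int i * d \<le> n" "n \<le> n + t * d" using True d_pos by auto
    ultimately have "n \<in> H" by (auto simp: chained_def)
    then show ?thesis using sumset_mono[OF zero_A assms] by (simp add: H_def)
  next
    case False
    then have "n + t * d + int (nat (- t)) * d \<in> sumset (h0 + nat (- t)) A"
      using sumset_add_mult[OF _ d_A] t(1) unfolding H_def by blast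
    then have "n \<in> sumset (h0 + nat (- t)) A" using False by simp
    then show ?thesis using sumset_mono[OF zero_A, of "h0 + nat (- t)" h n] t(2) assms by simp
  qed
qed

section \<open>Growth of intervals and the decomposition\<close>

text \<open>The translates by \<open>a 0, ..., a k\<close> overlap, because each step is shorter
  than \<open>N\<close>; their union is an interval longer by \<open>d\<close>.\<close>

lemma block_add:
  assumes "{x..<y + N} \<subseteq> sumset h A" "x \<le> y"
  shows "{x..<y + d + N} \<subseteq> sumset (Suc h) A"
proof -
  have "{x..<y + a j + N} \<subseteq> sumset (Suc h) A" if "j \<le> k" for j
    using that
  proof (induction j)
    case 0
    then show ?case using assms sumset_mono[OF zero_A, of h "Suc h"] a_0 by auto
  next
    case (Suc j)
    show ?case
    proof
      fix z assume z: "z \<in> {x..<y + a (Suc j) + N}"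
      show "z \<in> sumset (Suc h) A"
      proof (cases "z < y + a j + N")
        case True
        then show ?thesis using Suc z by auto
      next
        case False
        then have "z - a (Suc j) \<in> {x..<y + N}"
          using z assms(2) step_less[of "Suc j"] Suc.prems by auto
        then show ?thesis
          using sumset_add_elem[of "z - a (Suc j)" h A "a (Suc j)"] assms(1) a_A[OF Suc.prems] by auto
      qed
    qed
  qed
  from this[of k] show ?thesis by (simp add: d_def)
qed

lemma block_add_mult:
  assumes "{x..<x + N} \<subseteq> H"
  shows "{x..<x + int j * d + N} \<subseteq> sumset (h0 + j) A"
proof (induction j)
  case 0
  then show ?case using assms by (simp add: H_def)
next
  case (Suc j)
  from block_add[OF this] show ?case using d_pos by (simp add: algebra_simps)
qed

lemma block_exists: "\<exists>x. {x..<x + N} \<subseteq> H"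
proof -
  have "0 \<in> H" using sumset_mono[OF zero_A, of 0 h0 0] by (simp add: H_def sumset_0)
  then obtain par lab rk where "tree W par lab rk" by (rule chained_to_tree)
  then have "linked (total lab) (total lab)" by (rule tree_linked_refl)
  then show ?thesis by (intro exI[of _ "total lab"]) (auto simp: linked_def)
qed

lemma decomposition:
  "\<exists>c1 c2 C1 C2. \<forall>h\<ge>h0. sumset_decomposition A c1 c2 C1 C2 h"
proof -
  obtain x where x: "{x..<x + N} \<subseteq> H" using block_exists by blast
  have "{x..} \<subseteq> S"
  proof
    fix n assume n: "n \<in> {x..}"
    have "n - x \<le> int (nat (n - x)) * d" using n d_pos mult_left_mono[of 1 d "n - x"] by auto
    then have "n \<in> {x..<x + int (nat (n - x)) * d + N}" using n N_gt by auto
    then show "n \<in> S" using block_add_mult[OF x] unfolding S_def by blast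
  qed
  moreover have nonneg_S: "S \<subseteq> {0..}" using sumset_range unfolding S_def by blast
  ultimately obtain c1 where c1: "c1 \<le> x" "{c1..} \<subseteq> S" "c1 - 1 \<notin> S"
    using least_tail_start[of S x] by blast
  \<comment> \<open>The reflection of the last element of the block. It gives
    \<open>c1 + c2 \<le> int h0 * d - (N - 1)\<close>, so the middle interval is nonempty from
    \<open>h0\<close> on.\<close>
  let ?y = "int h0 * d - (x + N - 1)"
  have "{?y..} \<subseteq> S'"
  proof
    fix n assume n: "n \<in> {?y..}"
    define j where "j = nat \<bar>x - (int h0 * d - n)\<bar>"
    have "\<bar>x - (int h0 * d - n)\<bar> \<le> int j * d"
      using d_pos mult_left_mono[of 1 d "\<bar>x - (int h0 * d - n)\<bar>"] by (simp add: j_def)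
    then have "int (h0 + j) * d - n \<in> {x..<x + int j * d + N}"
      using n by (auto simp: algebra_simps)
    then show "n \<in> S'" using block_add_mult[OF x] unfolding S'_def by blast
  qed
  moreover have nonneg_S': "S' \<subseteq> {0..}"
  proof
    fix n assume "n \<in> S'"
    then obtain j where "int j * d - n \<in> sumset j A" by (auto simp: S'_def)
    from sumset_range[OF this] show "n \<in> {0..}" by simp
  qed
  ultimately obtain c2 where c2: "c2 \<le> ?y" "{c2..} \<subseteq> S'" "c2 - 1 \<notin> S'"
    using least_tail_start[of S' ?y] by blast
  have max: "Max A = d"
    using finite_A d_A A_range by (intro Max_eqI) auto
  have "sumset_decomposition A c1 c2 (S \<inter> {..c1 - 2}) (S' \<inter> {..c2 - 2}) h" if h: "h0 \<le> h" for h
    unfolding sumset_decomposition_def max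
  proof (intro conjI)
    show "S \<inter> {..c1 - 2} \<subseteq> {0..c1 - 2}" "S' \<inter> {..c2 - 2} \<subseteq> {0..c2 - 2}"
      using nonneg_S nonneg_S' by auto
    have "int h0 * d \<le> int h * d" using h d_pos by simp
    then show le: "c1 \<le> int h * d - c2" using c1(1) c2(1) N_gt by simp
    \<comment> \<open>Below \<open>c1\<close> the value \<open>c1 - 1\<close> is missing, so the
      elements of \<open>S\<close> there are at most \<open>c1 - 2\<close>.\<close>
    have S: "n \<in> S \<longleftrightarrow> c1 \<le> n \<or> n \<in> S \<inter> {..c1 - 2}" for n
      using c1(2,3) by (cases "n = c1 - 1") auto
    have S': "n \<in> S' \<longleftrightarrow> c2 \<le> n \<or> n \<in> S' \<inter> {..c2 - 2}" for n
      using c2(2,3) by (cases "n = c2 - 1") auto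
    have img: "n \<in> (\<lambda>x. int h * d - x) ` (S' \<inter> {..c2 - 2}) \<longleftrightarrow> int h * d - n \<in> S' \<inter> {..c2 - 2}" for n
      by (force simp: image_iff)
    show "sumset h A = S \<inter> {..c1 - 2} \<union> {c1..int h * d - c2} \<union>
        (\<lambda>x. int h * d - x) ` (S' \<inter> {..c2 - 2})"
    proof (rule set_eqI)
      fix n
      have "n \<in> sumset h A \<longleftrightarrow> n \<in> S \<and> int h * d - n \<in> S'" by (simp add: sumset_eq[OF h])
      then show "n \<in> sumset h A \<longleftrightarrow> n \<in> S \<inter> {..c1 - 2} \<union> {c1..int h * d - c2} \<union>
          (\<lambda>x. int h * d - x) ` (S' \<inter> {..c2 - 2})"
        unfolding Un_iff img S[of n] S'[of "int h * d - n"] using le by auto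
    qed
  qed
  then show ?thesis by blast
qed

end

theorem proposition5p9:
  fixes A :: "int set" and a :: "nat \<Rightarrow> int" and k :: nat
  assumes "k + 1 \<ge> 4"
    and "a 0 = 0"
    and "strict_mono_on {0..k} a"
    and "A = a ` {0..k}"
    and "Gcd A = 1"
  shows "int (sumsets_regularity A) \<le> max_gap a k + second_max_gap a k + 1"
proof -
  define M where "M = (ARG_MAX (gap a) i. i \<in> {1..k})"
  have gap_max: "gap a i \<le> max_gap a k" if "i \<in> {1..k}" for i
    unfolding max_gap_def using that by (intro Max_ge) auto
  have gap_second: "gap a i \<le> second_max_gap a k" if "i \<in> {1..k}" "i \<noteq> M" for i
    unfolding second_max_gap_def M_def[symmetric] using that by (intro Max_ge) auto
  \<comment> \<open>A gap is a difference minus 1, so the sum of two differences exceeds that of the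
    gaps by 2. Then \<open>h0\<close>, which is \<open>N - 1\<close>, equals the claimed
    bound.\<close>
  interpret step_sequence a k "max_gap a k + second_max_gap a k + 2"
  proof
    show "(a i - a (i - 1)) + (a j - a (j - 1)) \<le> max_gap a k + second_max_gap a k + 2"
      if "i \<in> {1..k}" "j \<in> {1..k}" "i \<noteq> j" for i j
      using gap_max[OF that(1)] gap_max[OF that(2)] gap_second[OF that(1)] gap_second[OF that(2)] that(3)
      unfolding gap_def by (cases "i = M") auto
  qed (use assms in auto)
  have "A = step_sequence.A a k" using assms(4) by (simp add: A_def)
  then have "sumsets_regularity A \<le> h0"
    unfolding sumsets_regularity_def using decomposition by (simp add: Least_le)
  then show ?thesis using N_gt by (simp add: h0_def)
qed

end
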